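(* A map $\varepsilon\colon X^{\times}_{\mathrm{irr}}\to\mathcal{P}(M)$ is a Fitch map if and only if (1) $\mathcal{N}[\varepsilon]$ is hierarchy-like, and (2) for every neighborhood $N=N_m[y]\in\mathcal{N}[\varepsilon]$ and every $y'\in N$ we have $|N_m[y']|\le|N|$.
   Context: $X$ is a finite nonempty set, $M$ a finite nonempty set of colors, $X^{\times}_{\mathrm{irr}}=\{(x,y)\in X\times X: x\neq y\}$. A phylogenetic tree on $X$ is a rooted tree whose leaves (non-root vertices of degree $1$) form $X$, whose root has degree $\ge2$ and whose non-root inner vertices have degree $\ge3$; $\mathrm{lca}(x,y)$ is the last common ancestor. An edge-labeled tree $(T,\lambda)$ on $X$ with $M$ is a phylogenetic tree $T$ on $X$ with $\lambda\colon E(T)\to\mathcal{P}(M)$; $e$ is an $m$-edge if $m\in\lambda(e)$. $(T,\lambda)$ explains $\varepsilon$ if for all $(x,y)\in X^{\times}_{\mathrm{irr}}$, $m\in M$: $m\in\varepsilon(x,y)$ iff the path from $\mathrm{lca}(x,y)$ to $y$ contains an $m$-edge; $\varepsilon$ is a Fitch map if some edge-labeled tree explains it. $N_m[y]=\{x\in X\setminus\{y\}: m\notin\varepsilon(x,y)\}\cup\{y\}$ and $\mathcal{N}[\varepsilon]=\{N_m[y]: y\in X, m\in M\}$. A set system is hierarchy-like if any two members $P,Q$ satisfy $P\cap Q\in\{P,Q,\emptyset\}$.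
   Formalization: For |X| = 1 no tree with root of degree ≥ 2 exists although (1) and (2) hold, so the one-vertex tree is also admitted as the phylogenetic tree on a one-element set X; for |X| ≥ 2 the statement is unchanged. *)

theory Defs
  imports Main "HOL-Library.FuncSet"
begin

section \<open>Rooted trees\<close>

text \<open>Edges are undirected: two-element sets of vertices.\<close>

record 'v rooted_graph =
  verts :: "'v set"
  edges :: "'v set set"
  root  :: 'v

definition adjacent :: "'v rooted_graph \<Rightarrow> 'v \<Rightarrow> 'v \<Rightarrow> bool" where
  "adjacent T u v \<longleftrightarrow> {u, v} \<in> edges T"

definition simple_graph :: "'v rooted_graph \<Rightarrow> bool" where
  "simple_graph T \<longleftrightarrow> finite (verts T) \<and> (\<forall>e\<in>edges T. e \<subseteq> verts T \<and> card e = 2)"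

definition is_path :: "'v rooted_graph \<Rightarrow> 'v \<Rightarrow> 'v list \<Rightarrow> 'v \<Rightarrow> bool" where
  "is_path T u p v \<longleftrightarrow>
     p \<noteq> [] \<and> hd p = u \<and> last p = v \<and> set p \<subseteq> verts T \<and> distinct p \<and> successively (adjacent T) p"

definition is_cycle :: "'v rooted_graph \<Rightarrow> 'v list \<Rightarrow> bool" where
  "is_cycle T p \<longleftrightarrow>
     3 \<le> length p \<and> set p \<subseteq> verts T \<and> distinct p \<and>
     successively (adjacent T) p \<and> adjacent T (last p) (hd p)"

definition rooted_tree :: "'v rooted_graph \<Rightarrow> bool" where
  "rooted_tree T \<longleftrightarrow>
     simple_graph T \<and> root T \<in> verts T \<and>
     (\<forall>u\<in>verts T. \<forall>v\<in>verts T. \<exists>p. is_path T u p v) \<and>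
     (\<nexists>p. is_cycle T p)"

definition degree :: "'v rooted_graph \<Rightarrow> 'v \<Rightarrow> nat" where
  "degree T v = card {e \<in> edges T. v \<in> e}"

definition leaves :: "'v rooted_graph \<Rightarrow> 'v set" where
  "leaves T = {v \<in> verts T. v \<noteq> root T \<and> degree T v = 1}"

text \<open>
  The second disjunct is the usual convention that the one-vertex tree is the phylogenetic tree
  on a one-element set. A tree whose root has degree at least \<open>2\<close> has at least two leaves, so this
  disjunct matters only for a one-element \<open>L\<close>, where the first disjunct cannot hold.
\<close>

definition phylogenetic_tree :: "'v rooted_graph \<Rightarrow> 'v set \<Rightarrow> bool" where
  "phylogenetic_tree T L \<longleftrightarrow>
     rooted_tree T \<and>
     ((leaves T = L \<and> degree T (root T) \<ge> 2 \<and>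
       (\<forall>v\<in>verts T - leaves T - {root T}. degree T v \<ge> 3))
      \<or> (verts T = {root T} \<and> L = {root T}))"

definition the_path :: "'v rooted_graph \<Rightarrow> 'v \<Rightarrow> 'v \<Rightarrow> 'v list" where
  "the_path T u v = (THE p. is_path T u p v)"

definition path_edges :: "'v list \<Rightarrow> 'v set set" where
  "path_edges p = {{p ! i, p ! Suc i} | i. Suc i < length p}"

definition ancestor :: "'v rooted_graph \<Rightarrow> 'v \<Rightarrow> 'v \<Rightarrow> bool" where
  "ancestor T u v \<longleftrightarrow> u \<in> set (the_path T (root T) v)"

definition lca :: "'v rooted_graph \<Rightarrow> 'v \<Rightarrow> 'v \<Rightarrow> 'v" where
  "lca T x y = (THE u. u \<in> verts T \<and> ancestor T u x \<and> ancestor T u y \<and>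
     (\<forall>w\<in>verts T. ancestor T w x \<and> ancestor T w y \<longrightarrow> ancestor T w u))"

section \<open>Fitch maps\<close>

definition irr :: "'a set \<Rightarrow> ('a \<times> 'a) set" where
  "irr X = {(x, y) \<in> X \<times> X. x \<noteq> y}"

text \<open>
  Vertices are taken from the type \<open>'a + nat\<close>, with \<open>x \<in> X\<close> represented as \<open>Inl x\<close>: the type \<open>'a\<close>
  need not have room for the inner vertices. As trees are finite, every phylogenetic tree on \<open>X\<close>
  is isomorphic, by an isomorphism fixing the leaves, to one of this form.
\<close>

definition edge_labeled_tree ::
  "('a + nat) rooted_graph \<Rightarrow> (('a + nat) set \<Rightarrow> 'm set) \<Rightarrow> 'a set \<Rightarrow> 'm set \<Rightarrow> bool" where
  "edge_labeled_tree T lab X M \<longleftrightarrow> phylogenetic_tree T (Inl ` X) \<and> lab \<in> edges T \<rightarrow> Pow M"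

definition explains ::
  "('a + nat) rooted_graph \<Rightarrow> (('a + nat) set \<Rightarrow> 'm set) \<Rightarrow> 'a set \<Rightarrow> 'm set
   \<Rightarrow> ('a \<times> 'a \<Rightarrow> 'm set) \<Rightarrow> bool" where
  "explains T lab X M \<epsilon> \<longleftrightarrow>
     (\<forall>(x, y)\<in>irr X. \<forall>m\<in>M.
        m \<in> \<epsilon> (x, y) \<longleftrightarrow>
        (\<exists>e\<in>path_edges (the_path T (lca T (Inl x) (Inl y)) (Inl y)). m \<in> lab e))"

definition fitch_map :: "'a set \<Rightarrow> 'm set \<Rightarrow> ('a \<times> 'a \<Rightarrow> 'm set) \<Rightarrow> bool" where
  "fitch_map X M \<epsilon> \<longleftrightarrow>
     (\<exists>T lab. edge_labeled_tree T lab X M \<and> explains T lab X M \<epsilon>)"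

definition nbh :: "'a set \<Rightarrow> ('a \<times> 'a \<Rightarrow> 'm set) \<Rightarrow> 'm \<Rightarrow> 'a \<Rightarrow> 'a set" where
  "nbh X \<epsilon> m y = {x \<in> X - {y}. m \<notin> \<epsilon> (x, y)} \<union> {y}"

definition nbhs :: "'a set \<Rightarrow> 'm set \<Rightarrow> ('a \<times> 'a \<Rightarrow> 'm set) \<Rightarrow> 'a set set" where
  "nbhs X M \<epsilon> = {nbh X \<epsilon> m y | y m. y \<in> X \<and> m \<in> M}"

definition hierarchy_like :: "'a set set \<Rightarrow> bool" where
  "hierarchy_like S \<longleftrightarrow> (\<forall>P\<in>S. \<forall>Q\<in>S. P \<inter> Q \<in> {P, Q, {}})"

end

theory Submission
  imports Defs "HOL-Library.Sublist"
begin

text \<open>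
  The edges on the path from \<open>lca(x, y)\<close> to \<open>y\<close> are those entering a vertex that is an ancestor
  of \<open>y\<close> but not of \<open>x\<close>. Hence in a labeled tree \<open>N_m[y]\<close> is the set of leaves below the deepest
  ancestor of \<open>y\<close> entered by an \<open>m\<close>-edge (below the root if there is none), which gives both
  conditions. Conversely, the neighborhoods together with \<open>X\<close> and the singletons form a hierarchy;
  label the edge entering a cluster \<open>Q\<close> of its Hasse tree by all \<open>m\<close> with \<open>Q = N_m[y]\<close> for
  some \<open>y\<close>. If \<open>y \<in> Q = N_m[y']\<close> and \<open>x \<notin> Q\<close>, then the two conditions force \<open>N_m[y] \<subseteq> Q\<close>,
  so \<open>x \<notin> N_m[y]\<close>; this is why no superfluous \<open>m\<close>-edges arise.
\<close>

section \<open>Paths\<close>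

lemma adjacent_commute: "adjacent T u v \<longleftrightarrow> adjacent T v u"
  by (simp add: adjacent_def insert_commute)

lemma successively_adjacent_rev:
  "successively (adjacent T) (rev p) \<longleftrightarrow> successively (adjacent T) p"
proof -
  have "(\<lambda>u v. adjacent T v u) = adjacent T" by (intro ext) (rule adjacent_commute)
  then show ?thesis unfolding successively_rev by (rule arg_cong[where f = "\<lambda>R. successively R p"])
qed

lemma adjacent_verts:
  assumes "simple_graph T" "adjacent T u v"
  shows "u \<in> verts T" "v \<in> verts T" "u \<noteq> v"
proof -
  have "{u, v} \<subseteq> verts T" "card {u, v} = 2"
    using assms unfolding simple_graph_def adjacent_def by blast+
  then show "u \<in> verts T" "v \<in> verts T" "u \<noteq> v" by auto
qed

lemma is_path_unique:
  assumes "\<nexists>c. is_cycle T c" "is_path T u p v" "is_path T u q v"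
  shows "p = q"
  using assms(2,3)
proof (induction p arbitrary: u q)
  case Nil
  then show ?case by (simp add: is_path_def)
next
  case (Cons u' p)
  have [simp]: "u' = u" using Cons.prems by (simp add: is_path_def)
  obtain q' where q [simp]: "q = u # q'"
    using Cons.prems(2) by (cases q) (auto simp: is_path_def)
  show ?case
  proof (cases "p = [] \<or> q' = []")
    case True
    have "u \<notin> set p" "u \<notin> set q'" "last (u # p) = v" "last (u # q') = v"
      using Cons.prems by (simp_all add: is_path_def)
    then have "p = [] \<and> q' = []" using True by (metis last.simps last_in_set)
    then show ?thesis by simp
  next
    case False
    then have ne: "p \<noteq> []" "q' \<noteq> []" by auto
    have lasts: "last p = v" "last q' = v" using Cons.prems ne by (auto simp: is_path_def)
    show ?thesis
    proof (cases "hd p = hd q'")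
      case True
      have "is_path T (hd p) p v" "is_path T (hd p) q' v"
        using Cons.prems ne True by (auto simp: is_path_def successively_Cons)
      then show ?thesis using Cons.IH by simp
    next
      case False
      have "\<exists>w\<in>set p. w \<in> set q'" using lasts ne by (metis last_in_set)
      then obtain a w b where p: "p = a @ w # b" and w: "w \<in> set q'"
        and a: "\<forall>z\<in>set a. z \<notin> set q'"
        using split_list_first_prop[of p "\<lambda>w. w \<in> set q'"] by blast
      obtain c d where q': "q' = c @ w # d" using w by (meson split_list)
      let ?c = "u # a @ w # rev c"
      have ac: "a \<noteq> [] \<or> c \<noteq> []" using False p q' by auto
      have dis: "distinct ?c"
        using Cons.prems a unfolding is_path_def p q' q by auto
      have succ: "successively (adjacent T) ((u # a) @ [w])"
        "successively (adjacent T) ((u # c) @ [w])"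
        using Cons.prems unfolding is_path_def p q' q
        by (auto simp: successively_append_iff successively_Cons hd_append)
      have "successively (adjacent T) (rev ((u # c) @ [w]))"
        using succ(2) successively_adjacent_rev by blast
      then have c1: "successively (adjacent T) (w # rev c)" "adjacent T (last (w # rev c)) u"
        by (auto simp: successively_append_iff successively_Cons hd_append split: if_splits)
      then have "successively (adjacent T) ?c"
        using succ(1) by (auto simp: successively_append_iff successively_Cons hd_append)
      moreover have "3 \<le> length ?c" using ac by (cases a; cases c) auto
      moreover have "set ?c \<subseteq> verts T"
        using Cons.prems unfolding is_path_def p q' q by auto
      ultimately have "is_cycle T ?c" using dis c1 by (auto simp: is_cycle_def)
      then show ?thesis using assms(1) by blast
    qed
  qed
qed

lemma is_path_snoc:
  assumes "is_path T u p v" "adjacent T v w" "w \<in> verts T" "w \<notin> set p"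
  shows "is_path T u (p @ [w]) w"
  using assms by (auto simp: is_path_def successively_append_iff)

lemma is_path_append_left:
  assumes "is_path T u (p @ q) v" "p \<noteq> []"
  shows "is_path T u p (last p)"
  using assms by (auto simp: is_path_def successively_append_iff)

lemma is_path_append_right:
  assumes "is_path T u (p @ q) v" "q \<noteq> []"
  shows "is_path T (hd q) q v"
  using assms by (auto simp: is_path_def successively_append_iff)

lemma reachable_imp_is_path:
  assumes "simple_graph T" "(adjacent T)\<^sup>*\<^sup>* u v" "u \<in> verts T"
  shows "\<exists>p. is_path T u p v"
  using assms(2)
proof (induction rule: rtranclp_induct)
  case base
  have "is_path T u [u] u" using assms(3) by (simp add: is_path_def)
  then show ?case by blast
next
  case (step v w)
  then obtain p where p: "is_path T u p v" by blast
  show ?case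
  proof (cases "w \<in> set p")
    case True
    then obtain s t where "p = (s @ [w]) @ t" by (metis append.assoc append_Cons append_Nil split_list)
    then show ?thesis using is_path_append_left p by (metis last_snoc snoc_eq_iff_butlast)
  next
    case False
    then show ?thesis using is_path_snoc p step adjacent_verts[OF assms(1)] by metis
  qed
qed

lemma is_path_imp_reachable:
  assumes "is_path T u p v"
  shows "(adjacent T)\<^sup>*\<^sup>* u v"
  using assms
proof (induction p arbitrary: u)
  case (Cons a p)
  show ?case
  proof (cases "p = []")
    case False
    then have "is_path T (hd p) p v" "adjacent T u (hd p)"
      using Cons.prems by (auto simp: is_path_def successively_Cons)
    then show ?thesis using Cons.IH by (meson converse_rtranclp_into_rtranclp)
  qed (use Cons.prems in \<open>auto simp: is_path_def\<close>)
qed (simp add: is_path_def)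

lemma path_edges_iff:
  "e \<in> path_edges p \<longleftrightarrow> (\<exists>s a b t. p = s @ a # b # t \<and> e = {a, b})"
proof
  assume "e \<in> path_edges p"
  then obtain i where i: "Suc i < length p" "e = {p ! i, p ! Suc i}"
    by (auto simp: path_edges_def)
  then have "p = take i p @ p ! i # p ! Suc i # drop (Suc (Suc i)) p"
    by (metis Cons_nth_drop_Suc Suc_lessD append_take_drop_id)
  then show "\<exists>s a b t. p = s @ a # b # t \<and> e = {a, b}" using i by blast
next
  assume "\<exists>s a b t. p = s @ a # b # t \<and> e = {a, b}"
  then obtain s a b t where "p = s @ a # b # t" "e = {a, b}" by blast
  then show "e \<in> path_edges p"
    unfolding path_edges_def by (auto intro!: exI[of _ "length s"] simp: nth_append)
qed

section \<open>Ancestors and last common ancestors\<close>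

locale tree =
  fixes T :: "'v rooted_graph"
  assumes rooted_tree: "rooted_tree T"
begin

lemma simple: "simple_graph T"
  and root_in_verts: "root T \<in> verts T"
  and acyclic: "\<nexists>c. is_cycle T c"
  using rooted_tree by (auto simp: rooted_tree_def)

lemma the_path_eqI:
  assumes "is_path T u p v"
  shows "the_path T u v = p"
  unfolding the_path_def using assms is_path_unique[OF acyclic] by (intro the_equality)

lemma is_path_the_path:
  assumes "u \<in> verts T" "v \<in> verts T"
  shows "is_path T u (the_path T u v) v"
proof -
  obtain p where "is_path T u p v" using assms rooted_tree unfolding rooted_tree_def by blast
  then show ?thesis using the_path_eqI by metis
qed

abbreviation root_path :: "'v \<Rightarrow> 'v list" where
  "root_path v \<equiv> the_path T (root T) v"

lemma is_path_root_path: "v \<in> verts T \<Longrightarrow> is_path T (root T) (root_path v) v"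
  using is_path_the_path root_in_verts by blast

lemma root_path_nonempty: "v \<in> verts T \<Longrightarrow> root_path v \<noteq> []"
  and last_root_path: "v \<in> verts T \<Longrightarrow> last (root_path v) = v"
  and hd_root_path: "v \<in> verts T \<Longrightarrow> hd (root_path v) = root T"
  and root_path_verts: "v \<in> verts T \<Longrightarrow> set (root_path v) \<subseteq> verts T"
  using is_path_root_path[of v] by (auto simp: is_path_def)

lemma root_path_prefixI:
  assumes "v \<in> verts T" "prefix p (root_path v)" "p \<noteq> []"
  shows "last p \<in> verts T" "root_path (last p) = p"
proof -
  obtain q where q: "root_path v = p @ q" using assms(2) by (auto simp: prefix_def)
  then have "is_path T (root T) p (last p)"
    using is_path_root_path[OF assms(1)] is_path_append_left assms(3) by metis
  then show "root_path (last p) = p" by (rule the_path_eqI)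
  show "last p \<in> verts T"
    using \<open>is_path T (root T) p (last p)\<close> by (auto simp: is_path_def)
qed

lemma ancestor_verts: "ancestor T u v \<Longrightarrow> v \<in> verts T \<Longrightarrow> u \<in> verts T"
  using root_path_verts by (auto simp: ancestor_def)

lemma ancestor_iff_prefix:
  assumes "u \<in> verts T" "v \<in> verts T"
  shows "ancestor T u v \<longleftrightarrow> prefix (root_path u) (root_path v)"
proof
  assume "ancestor T u v"
  then obtain s t where "root_path v = (s @ [u]) @ t"
    unfolding ancestor_def by (metis append.assoc append_Cons append_Nil split_list)
  then have "prefix (s @ [u]) (root_path v)" by (metis prefixI)
  then show "prefix (root_path u) (root_path v)"
    using root_path_prefixI(2)[OF assms(2)] by fastforce
next
  assume "prefix (root_path u) (root_path v)"
  then show "ancestor T u v"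
    unfolding ancestor_def using root_path_nonempty last_root_path assms
    by (metis last_in_set set_mono_prefix subsetD)
qed

lemma ancestor_refl: "v \<in> verts T \<Longrightarrow> ancestor T v v"
  by (simp add: ancestor_iff_prefix)

lemma ancestor_root: "v \<in> verts T \<Longrightarrow> ancestor T (root T) v"
  unfolding ancestor_def using hd_in_set[OF root_path_nonempty, of v] by (simp add: hd_root_path)

lemma ancestor_trans:
  assumes "ancestor T u v" "ancestor T v w" "w \<in> verts T"
  shows "ancestor T u w"
proof -
  have "v \<in> verts T" "u \<in> verts T" using assms ancestor_verts by blast+
  then show ?thesis using assms by (auto simp: ancestor_iff_prefix intro: prefix_order.trans)
qed

lemma ancestor_antisym:
  assumes "ancestor T u v" "ancestor T v u" "v \<in> verts T"
  shows "u = v"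
proof -
  have "u \<in> verts T" using assms ancestor_verts by blast
  then have "root_path u = root_path v"
    using assms by (simp add: ancestor_iff_prefix prefix_order.antisym)
  then show ?thesis using last_root_path assms(3) \<open>u \<in> verts T\<close> by metis
qed

lemma ancestors_linear:
  assumes "ancestor T u w" "ancestor T v w" "w \<in> verts T"
  shows "ancestor T u v \<or> ancestor T v u"
proof -
  have "u \<in> verts T" "v \<in> verts T" using assms ancestor_verts by blast+
  then show ?thesis using assms prefix_same_cases by (simp add: ancestor_iff_prefix) blast
qed

lemma root_path_snoc:
  assumes "adjacent T u w" "ancestor T u w"
  shows "root_path w = root_path u @ [w]"
proof -
  have uw: "u \<in> verts T" "w \<in> verts T" "u \<noteq> w" using adjacent_verts[OF simple assms(1)] by auto
  then have "w \<notin> set (root_path u)"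
    using ancestor_antisym assms(2) by (auto simp: ancestor_def)
  then show ?thesis
    using is_path_snoc[OF is_path_root_path] assms(1) uw by (simp add: the_path_eqI)
qed

lemma lca_properties:
  assumes "x \<in> verts T" "y \<in> verts T"
  shows lca_in_verts: "lca T x y \<in> verts T"
    and ancestor_lca_iff: "w \<in> verts T \<Longrightarrow>
      ancestor T w (lca T x y) \<longleftrightarrow> ancestor T w x \<and> ancestor T w y"
proof -
  define l where "l = longest_common_prefix (root_path x) (root_path y)"
  have pl: "prefix l (root_path x)" "prefix l (root_path y)"
    unfolding l_def using longest_common_prefix_prefix1 longest_common_prefix_prefix2 by blast+
  have "root_path z = root T # tl (root_path z)" if "z \<in> verts T" for z
    using root_path_nonempty[OF that] hd_root_path[OF that] by (metis list.collapse)
  then have "prefix [root T] (root_path x)" "prefix [root T] (root_path y)"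
    using assms by (metis Cons_prefix_Cons Nil_prefix)+
  then have "prefix [root T] l" unfolding l_def by (rule longest_common_prefix_max_prefix)
  then have "l \<noteq> []" by auto
  note l = root_path_prefixI[OF assms(1) pl(1) this]
  have iff: "ancestor T w (last l) \<longleftrightarrow> ancestor T w x \<and> ancestor T w y"
    if "w \<in> verts T" for w
  proof -
    have "ancestor T w (last l) \<longleftrightarrow> prefix (root_path w) l"
      using ancestor_iff_prefix that l by simp
    also have "\<dots> \<longleftrightarrow> prefix (root_path w) (root_path x) \<and> prefix (root_path w) (root_path y)"
      using pl longest_common_prefix_max_prefix[of "root_path w"] prefix_order.trans
      unfolding l_def by blast
    finally show ?thesis using ancestor_iff_prefix that assms by simp
  qed
  have "lca T x y = last l"
    unfolding lca_def
  proof (rule the_equality)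
    show "last l \<in> verts T \<and> ancestor T (last l) x \<and> ancestor T (last l) y \<and>
      (\<forall>w\<in>verts T. ancestor T w x \<and> ancestor T w y \<longrightarrow> ancestor T w (last l))"
      using iff l ancestor_refl by blast
  next
    fix u
    assume u: "u \<in> verts T \<and> ancestor T u x \<and> ancestor T u y \<and>
      (\<forall>w\<in>verts T. ancestor T w x \<and> ancestor T w y \<longrightarrow> ancestor T w u)"
    have "ancestor T (last l) u" using u iff[OF l(1)] ancestor_refl[OF l(1)] l(1) by blast
    moreover have "ancestor T u (last l)" using u iff by blast
    ultimately show "u = last l" using ancestor_antisym l(1) by blast
  qed
  then show "lca T x y \<in> verts T" "w \<in> verts T \<Longrightarrow>
      ancestor T w (lca T x y) \<longleftrightarrow> ancestor T w x \<and> ancestor T w y"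
    using l iff by auto
qed

lemma path_edges_lca:
  assumes "x \<in> verts T" "y \<in> verts T"
  shows "e \<in> path_edges (the_path T (lca T x y) y) \<longleftrightarrow>
    (\<exists>u w. e = {u, w} \<and> adjacent T u w \<and> ancestor T u w \<and> ancestor T w y \<and> \<not> ancestor T w x)"
proof -
  define l where "l = lca T x y"
  have l: "l \<in> verts T" using lca_in_verts assms by (simp add: l_def)
  have anc: "ancestor T w l \<longleftrightarrow> ancestor T w x \<and> ancestor T w y" if "w \<in> verts T" for w
    using ancestor_lca_iff assms that by (simp add: l_def)
  have "ancestor T l y" using anc l ancestor_refl by blast
  then obtain t where t: "root_path y = root_path l @ t"
    using ancestor_iff_prefix l assms by (auto simp: prefix_def)
  obtain p where p: "root_path l = p @ [l]"
    using root_path_nonempty last_root_path l by (metis append_butlast_last_id)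
  have "is_path T (hd (l # t)) (l # t) y"
    using is_path_root_path[OF assms(2)] is_path_append_right[of T _ p "l # t"] t p by simp
  then have path: "the_path T l y = l # t" by (simp add: the_path_eqI)
  show ?thesis
  proof
    assume "e \<in> path_edges (the_path T (lca T x y) y)"
    then obtain s a b s' where s: "l # t = s @ a # b # s'" and e: "e = {a, b}"
      using path by (auto simp: path_edges_iff l_def)
    have y: "root_path y = (p @ s @ [a, b]) @ s'" using t p s by simp
    have b: "b \<in> verts T" "root_path b = p @ s @ [a, b]"
      using root_path_prefixI[OF assms(2), of "p @ s @ [a, b]"] y by (auto simp: prefix_def)
    have "adjacent T a b"
      using is_path_root_path[OF assms(2)] y by (auto simp: is_path_def successively_append_iff)
    moreover have "ancestor T a b" using b by (simp add: ancestor_def)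
    moreover have "ancestor T b y" using y by (simp add: ancestor_def)
    moreover have "\<not> ancestor T b l"
      using b p ancestor_iff_prefix l prefix_length_le by fastforce
    then have "\<not> ancestor T b x" using anc b calculation by blast
    ultimately show "\<exists>u w. e = {u, w} \<and> adjacent T u w \<and> ancestor T u w \<and>
        ancestor T w y \<and> \<not> ancestor T w x"
      using e by blast
  next
    assume "\<exists>u w. e = {u, w} \<and> adjacent T u w \<and> ancestor T u w \<and>
        ancestor T w y \<and> \<not> ancestor T w x"
    then obtain u w where e: "e = {u, w}" and uw: "adjacent T u w" "ancestor T u w"
      and w: "ancestor T w y" "\<not> ancestor T w x" by blast
    have V: "u \<in> verts T" "w \<in> verts T" using adjacent_verts[OF simple uw(1)] by auto
    have rw: "root_path w = root_path u @ [w]" using root_path_snoc uw by blast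
    have "\<not> ancestor T w l" using anc V w by blast
    then have "ancestor T l w" using ancestors_linear w \<open>ancestor T l y\<close> assms by blast
    then have "prefix (root_path l) (root_path u)"
      using rw ancestor_iff_prefix l V \<open>\<not> ancestor T w l\<close> by (metis prefix_snoc prefix_order.refl)
    then obtain z where z: "root_path u = root_path l @ z" by (auto simp: prefix_def)
    have "prefix (root_path w) (root_path y)" using w V assms ancestor_iff_prefix by blast
    then obtain t' where "root_path y = root_path w @ t'" by (auto simp: prefix_def)
    then have t': "t = z @ w # t'" using t z rw by simp
    have "last (l # z) = u" using last_root_path[OF V(1)] z p by (auto split: if_splits)
    then have "l # z = butlast (l # z) @ [u]" by (metis append_butlast_last_id list.distinct(1))
    then have "l # t = butlast (l # z) @ u # w # t'" using t'
      by (metis append.assoc append_Cons append_Nil)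
    then show "e \<in> path_edges (the_path T (lca T x y) y)"
      using path e path_edges_iff l_def by metis
  qed
qed

end

section \<open>Fitch maps have hierarchy-like neighborhoods\<close>

lemma explains_iff:
  assumes "rooted_tree T" "Inl ` X \<subseteq> verts T"
  shows "explains T lab X M \<epsilon> \<longleftrightarrow>
    (\<forall>(x, y)\<in>irr X. \<forall>m\<in>M. m \<in> \<epsilon> (x, y) \<longleftrightarrow>
      (\<exists>u w. adjacent T u w \<and> ancestor T u w \<and> ancestor T w (Inl y) \<and> \<not> ancestor T w (Inl x) \<and>
         m \<in> lab {u, w}))"
proof -
  interpret tree T using assms by unfold_locales
  have "(\<exists>e\<in>path_edges (the_path T (lca T (Inl x) (Inl y)) (Inl y)). m \<in> lab e) \<longleftrightarrow>
    (\<exists>u w. adjacent T u w \<and> ancestor T u w \<and> ancestor T w (Inl y) \<and> \<not> ancestor T w (Inl x) \<and>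
         m \<in> lab {u, w})" if "(x, y) \<in> irr X" for x y m
  proof -
    have V: "Inl x \<in> verts T" "Inl y \<in> verts T" using that assms(2) by (auto simp: irr_def)
    show ?thesis unfolding Bex_def path_edges_lca[OF V] by blast
  qed
  then show ?thesis unfolding explains_def by (simp add: Ball_def split_beta)
qed

lemma fitch_map_imp:
  assumes "finite X" "fitch_map X M \<epsilon>"
  shows "hierarchy_like (nbhs X M \<epsilon>)"
    and "\<forall>y\<in>X. \<forall>m\<in>M. \<forall>y'\<in>nbh X \<epsilon> m y. card (nbh X \<epsilon> m y') \<le> card (nbh X \<epsilon> m y)"
proof -
  obtain T lab where T: "phylogenetic_tree T (Inl ` X)" and expl: "explains T lab X M \<epsilon>"
    using assms(2) by (auto simp: fitch_map_def edge_labeled_tree_def)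
  have rt: "rooted_tree T" using T by (simp add: phylogenetic_tree_def)
  interpret tree T using rt by unfold_locales
  have X: "Inl ` X \<subseteq> verts T" using T root_in_verts by (auto simp: phylogenetic_tree_def leaves_def)
  then have X': "Inl x \<in> verts T" if "x \<in> X" for x using that by blast
  define labeled where
    "labeled m w \<longleftrightarrow> (\<exists>u. adjacent T u w \<and> ancestor T u w \<and> m \<in> lab {u, w})" for m w
  define C where "C w = {x \<in> X. ancestor T w (Inl x)}" for w
  have nbh: "nbh X \<epsilon> m y = {x \<in> X. \<forall>w. ancestor T w (Inl y) \<and> labeled m w \<longrightarrow> ancestor T w (Inl x)}"
    if "y \<in> X" "m \<in> M" for y m
    using expl[unfolded explains_iff[OF rt X]] that unfolding nbh_def labeled_def irr_def by blast
  have deepest: "\<exists>v. ancestor T v (Inl y) \<and> (v = root T \<or> labeled m v) \<and> nbh X \<epsilon> m y = C v"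
    if y: "y \<in> X" and m: "m \<in> M" for y m
  proof -
    let ?f = "\<lambda>w. length (root_path w)"
    let ?A = "{w. ancestor T w (Inl y) \<and> (w = root T \<or> labeled m w)}"
    have "finite ?A" by (rule finite_subset[of _ "set (root_path (Inl y))"]) (auto simp: ancestor_def)
    moreover have "root T \<in> ?A" using X' y ancestor_root by blast
    ultimately have "Max (?f ` ?A) \<in> ?f ` ?A" using Max_in by blast
    then obtain v where v: "v \<in> ?A" and fv: "Max (?f ` ?A) = ?f v" by (rule imageE)
    have max: "?f w \<le> ?f v" if "w \<in> ?A" for w
      unfolding fv[symmetric] by (rule Max_ge[OF finite_imageI[OF \<open>finite ?A\<close>] imageI[OF that]])
    have below: "ancestor T w v" if w: "w \<in> ?A" for w
    proof -
      have "ancestor T w v \<or> ancestor T v w" using ancestors_linear v w X' y by blast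
      then show "ancestor T w v"
      proof
        assume vw: "ancestor T v w"
        have V: "v \<in> verts T" "w \<in> verts T" using ancestor_verts v w X' y by blast+
        have "prefix (root_path v) (root_path w)" using vw ancestor_iff_prefix V by blast
        then have "root_path v = root_path w"
          using max[OF w] by (auto simp: prefix_def)
        then show "ancestor T w v" using ancestor_iff_prefix V by simp
      qed
    qed
    have "nbh X \<epsilon> m y = C v"
      unfolding nbh[OF y m] C_def
    proof (intro Collect_cong conj_cong refl iffI allI impI)
      fix x w assume "x \<in> X" "ancestor T v (Inl x)" "ancestor T w (Inl y) \<and> labeled m w"
      then show "ancestor T w (Inl x)" using below ancestor_trans X' by blast
    next
      fix x assume "x \<in> X" "\<forall>w. ancestor T w (Inl y) \<and> labeled m w \<longrightarrow> ancestor T w (Inl x)"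
      then show "ancestor T v (Inl x)" using v ancestor_root X' by blast
    qed
    then show ?thesis using v by blast
  qed
  have C_nested: "C u \<inter> C v \<in> {C u, C v, {}}" for u v
  proof (cases "C u \<inter> C v = {}")
    case False
    then have "ancestor T u v \<or> ancestor T v u" using ancestors_linear X' by (auto simp: C_def)
    then have "C v \<subseteq> C u \<or> C u \<subseteq> C v" using ancestor_trans X' by (auto simp: C_def)
    then show ?thesis by blast
  qed simp
  show "hierarchy_like (nbhs X M \<epsilon>)"
    unfolding hierarchy_like_def
  proof (intro ballI)
    fix P Q assume "P \<in> nbhs X M \<epsilon>" "Q \<in> nbhs X M \<epsilon>"
    then obtain y m y' m' where
      "P = nbh X \<epsilon> m y" "y \<in> X" "m \<in> M" "Q = nbh X \<epsilon> m' y'" "y' \<in> X" "m' \<in> M"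
      unfolding nbhs_def by blast
    moreover from this obtain u v where "nbh X \<epsilon> m y = C u" "nbh X \<epsilon> m' y' = C v"
      using deepest by meson
    ultimately have "P = C u" "Q = C v" by simp_all
    then show "P \<inter> Q \<in> {P, Q, {}}" using C_nested by simp
  qed
  show "\<forall>y\<in>X. \<forall>m\<in>M. \<forall>y'\<in>nbh X \<epsilon> m y. card (nbh X \<epsilon> m y') \<le> card (nbh X \<epsilon> m y)"
  proof (intro ballI)
    fix y m y' assume y: "y \<in> X" and m: "m \<in> M" and y': "y' \<in> nbh X \<epsilon> m y"
    obtain v where v: "v = root T \<or> labeled m v" "nbh X \<epsilon> m y = C v" using deepest y m by blast
    have "y' \<in> X" "ancestor T v (Inl y')" using y' v by (auto simp: C_def)
    then have "nbh X \<epsilon> m y' \<subseteq> C v"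
      using nbh[of y' m] m v ancestor_root X' by (auto simp: C_def)
    then show "card (nbh X \<epsilon> m y') \<le> card (nbh X \<epsilon> m y)"
      using v assms(1) by (simp add: C_def card_mono)
  qed
qed

section \<open>The tree of a hierarchy\<close>

lemma is_cycle_two_neighbours:
  assumes "is_cycle T c" "v \<in> set c"
  shows "\<exists>a\<in>set c. \<exists>b\<in>set c. a \<noteq> b \<and> adjacent T v a \<and> adjacent T v b"
proof -
  obtain s t where c: "c = s @ v # t" using assms(2) by (meson split_list)
  let ?q = "t @ s"
  have len: "length ?q \<ge> 2" using assms(1) c by (auto simp: is_cycle_def)
  then obtain a q where q: "?q = a # q" "q \<noteq> []"
    by (metis Suc_le_length_iff numeral_2_eq_2 list.distinct(1))
  have "adjacent T v (hd ?q)"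
    using assms(1) len unfolding is_cycle_def c
    by (cases t; cases s) (auto simp: successively_append_iff successively_Cons)
  moreover have "adjacent T (last ?q) v"
    using assms(1) len unfolding is_cycle_def c
    by (cases t rule: rev_cases; cases s rule: rev_cases)
      (auto simp: successively_append_iff successively_Cons)
  then have "adjacent T v (last ?q)" by (rule iffD1[OF adjacent_commute])
  moreover have "distinct ?q" using assms(1) by (auto simp: is_cycle_def c)
  then have "hd ?q \<noteq> last ?q" using q by auto
  moreover have "set ?q \<subseteq> set c" using c by auto
  then have "hd ?q \<in> set c" "last ?q \<in> set c" using q by (auto simp del: set_append)
  ultimately show ?thesis by blast
qed

text \<open>
  A hierarchy on the set \<open>D r\<close> containing \<open>D r\<close> and all singletons, with its members \<open>D v\<close>
  indexed without repetition by the vertices \<open>v\<close> of the tree to be built.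
\<close>

locale hierarchy =
  fixes V :: "'v set" and D :: "'v \<Rightarrow> 'a set" and r :: 'v
  assumes finite_V: "finite V"
    and r_in_V: "r \<in> V"
    and D_subset: "v \<in> V \<Longrightarrow> D v \<subseteq> D r"
    and D_nonempty: "v \<in> V \<Longrightarrow> D v \<noteq> {}"
    and inj_D: "inj_on D V"
    and nested: "u \<in> V \<Longrightarrow> v \<in> V \<Longrightarrow> D u \<inter> D v \<noteq> {} \<Longrightarrow> D u \<subseteq> D v \<or> D v \<subseteq> D u"
    and singletons: "x \<in> D r \<Longrightarrow> \<exists>v\<in>V. D v = {x}"
    and finite_D_r: "finite (D r)"
begin

definition covers :: "'v \<Rightarrow> 'v \<Rightarrow> bool" where
  "covers u v \<longleftrightarrow> u \<in> V \<and> v \<in> V \<and> D v \<subset> D u \<and> \<not> (\<exists>w\<in>V. D v \<subset> D w \<and> D w \<subset> D u)"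

definition hasse_tree :: "'v rooted_graph" where
  "hasse_tree = \<lparr>verts = V, edges = {{u, v} | u v. covers u v}, root = r\<rparr>"

lemma hasse_tree_simps [simp]:
  "verts hasse_tree = V" "root hasse_tree = r"
  "edges hasse_tree = {{u, v} | u v. covers u v}"
  by (simp_all add: hasse_tree_def)

lemma adjacent_iff: "adjacent hasse_tree u v \<longleftrightarrow> covers u v \<or> covers v u"
  by (auto simp: adjacent_def doubleton_eq_iff)

lemma D_eqD: "D u = D v \<Longrightarrow> u \<in> V \<Longrightarrow> v \<in> V \<Longrightarrow> u = v"
  using inj_D by (auto dest: inj_onD)

lemma superset_iff:
  assumes "covers u v" "w \<in> V"
  shows "D v \<subseteq> D w \<longleftrightarrow> w = v \<or> D u \<subseteq> D w"
proof
  assume vw: "D v \<subseteq> D w"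
  have uv: "u \<in> V" "v \<in> V" "D v \<subset> D u" using assms by (auto simp: covers_def)
  then have "D u \<inter> D w \<noteq> {}" using vw D_nonempty[of v] by blast
  then have "D u \<subseteq> D w \<or> D w \<subset> D u" using nested uv assms by blast
  moreover have "D w = D v" if "D w \<subset> D u"
    using that vw assms by (auto simp: covers_def)
  ultimately show "w = v \<or> D u \<subseteq> D w" using D_eqD uv assms by blast
qed (use assms in \<open>auto simp: covers_def\<close>)

lemma covers_unique:
  assumes "covers u v" "covers u' v"
  shows "u = u'"
proof -
  have "D u \<subseteq> D u'" using superset_iff[OF assms(1), of u'] assms by (auto simp: covers_def)
  moreover have "D u' \<subseteq> D u" using superset_iff[OF assms(2), of u] assms by (auto simp: covers_def)
  ultimately show ?thesis using D_eqD assms by (auto simp: covers_def)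
qed

lemma covers_exists:
  assumes "v \<in> V" "v \<noteq> r"
  shows "\<exists>u. covers u v"
proof -
  let ?A = "D ` {w \<in> V. D v \<subset> D w}"
  have "D v \<subset> D r" using D_subset assms D_eqD r_in_V by blast
  then have "finite ?A" "?A \<noteq> {}" using finite_V r_in_V by auto
  then have "\<exists>P\<in>?A. \<forall>Q\<in>?A. Q \<subseteq> P \<longrightarrow> P = Q" by (rule finite_has_minimal)
  then obtain P where P: "P \<in> ?A" "\<forall>Q\<in>?A. Q \<subseteq> P \<longrightarrow> P = Q" by (rule bexE)
  then obtain u where "P = D u" "u \<in> V" "D v \<subset> D u" by auto
  then have "covers u v" using P assms unfolding covers_def by blast
  then show ?thesis by blast
qed

lemma covered_exists:
  assumes "v \<in> V" "w \<in> V" "D w \<subset> D v"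
  shows "\<exists>c. covers v c \<and> D w \<subseteq> D c"
proof -
  let ?A = "D ` {c \<in> V. D w \<subseteq> D c \<and> D c \<subset> D v}"
  have "finite ?A" "?A \<noteq> {}" using finite_V assms by auto
  then have "\<exists>P\<in>?A. \<forall>Q\<in>?A. P \<subseteq> Q \<longrightarrow> P = Q" by (rule finite_has_maximal)
  then obtain P where P: "P \<in> ?A" "\<forall>Q\<in>?A. P \<subseteq> Q \<longrightarrow> P = Q" by (rule bexE)
  then obtain c where c: "P = D c" "c \<in> V" "D w \<subseteq> D c" "D c \<subset> D v" by auto
  have "covers v c"
    unfolding covers_def
  proof (intro conjI notI)
    assume "\<exists>z\<in>V. D c \<subset> D z \<and> D z \<subset> D v"
    then obtain z where "z \<in> V" "D c \<subset> D z" "D z \<subset> D v" by blast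
    moreover from this have "D z \<in> ?A" using c by blast
    ultimately show False using P(2) c(1) by blast
  qed (use assms c in auto)
  then show ?thesis using c by blast
qed

lemma two_children:
  assumes "v \<in> V" "\<nexists>x. D v = {x}"
  shows "\<exists>a b. a \<noteq> b \<and> covers v a \<and> covers v b"
proof -
  have child: "\<exists>c. covers v c \<and> x \<in> D c" if x: "x \<in> D v" for x
  proof -
    obtain w where w: "w \<in> V" "D w = {x}"
      using singletons D_subset[OF assms(1)] x by (meson subsetD)
    have "D w \<noteq> D v" using w(2) assms(2) by metis
    then have "D w \<subset> D v" using x w(2) by auto
    then show ?thesis using covered_exists[OF assms(1) w(1)] w(2) by auto
  qed
  obtain x where "x \<in> D v" using D_nonempty[OF assms(1)] by blast
  then obtain a where a: "covers v a" using child by blast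
  then obtain y where y: "y \<in> D v" "y \<notin> D a" by (auto simp: covers_def)
  then obtain b where b: "covers v b" "y \<in> D b" using child by blast
  then have "a \<noteq> b" using y(2) by metis
  then show ?thesis using a b(1) by blast
qed

lemma simple_graph_hasse_tree: "simple_graph hasse_tree"
  unfolding simple_graph_def
proof (intro conjI ballI)
  fix e assume "e \<in> edges hasse_tree"
  then obtain u v where "e = {u, v}" "covers u v" by auto
  moreover from this have "u \<noteq> v" by (auto simp: covers_def)
  ultimately show "e \<subseteq> verts hasse_tree" "card e = 2" by (auto simp: covers_def)
qed (use finite_V in simp)

lemma acyclic_hasse_tree: "\<nexists>c. is_cycle hasse_tree c"
proof
  assume "\<exists>c. is_cycle hasse_tree c"
  then obtain c where c: "is_cycle hasse_tree c" by blast
  then have "finite (D ` set c)" "D ` set c \<noteq> {}" by (auto simp: is_cycle_def)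
  then have "\<exists>P\<in>D ` set c. \<forall>Q\<in>D ` set c. Q \<subseteq> P \<longrightarrow> P = Q" by (rule finite_has_minimal)
  then obtain P where P: "P \<in> D ` set c" "\<forall>Q\<in>D ` set c. Q \<subseteq> P \<longrightarrow> P = Q" by (rule bexE)
  then obtain v where v: "v \<in> set c" "P = D v" by blast
  have up: "covers a v" if "a \<in> set c" "adjacent hasse_tree v a" for a
  proof -
    have "D v = D a" if "D a \<subseteq> D v" using P(2) v(2) \<open>a \<in> set c\<close> that by blast
    then have "\<not> covers v a" unfolding covers_def by blast
    then show ?thesis using that(2) by (simp add: adjacent_iff)
  qed
  obtain a b where "a \<in> set c" "b \<in> set c" "a \<noteq> b"
    "adjacent hasse_tree v a" "adjacent hasse_tree v b"
    using is_cycle_two_neighbours[OF c v(1)] by blast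
  then show False using up covers_unique by blast
qed

lemma root_path_exists:
  assumes "v \<in> V"
  shows "\<exists>p. is_path hasse_tree r p v \<and> set p = {w \<in> V. D v \<subseteq> D w}"
  using assms
proof (induction "card (D r - D v)" arbitrary: v rule: less_induct)
  case less
  show ?case
  proof (cases "v = r")
    case True
    have "w = r" if "w \<in> V" "D r \<subseteq> D w" for w
      using that D_subset[of w] D_eqD[of w r] r_in_V by blast
    then have "is_path hasse_tree r [r] v" "set [r] = {w \<in> V. D v \<subseteq> D w}"
      using r_in_V True by (auto simp: is_path_def)
    then show ?thesis by blast
  next
    case False
    then obtain u where u: "covers u v" using covers_exists less.prems by blast
    then have uV: "u \<in> V" "D v \<subset> D u" by (auto simp: covers_def)
    then have "D r - D u \<subset> D r - D v" using D_subset by blast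
    then have "card (D r - D u) < card (D r - D v)" using finite_D_r by (simp add: psubset_card_mono)
    then obtain p where p: "is_path hasse_tree r p u" "set p = {w \<in> V. D u \<subseteq> D w}"
      using less.hyps uV by blast
    have "is_path hasse_tree r (p @ [v]) v"
      using is_path_snoc[OF p(1)] u p(2) uV less.prems by (auto simp: adjacent_iff)
    moreover have "{w \<in> V. D v \<subseteq> D w} = insert v {w \<in> V. D u \<subseteq> D w}"
      using superset_iff[OF u] less.prems by blast
    then have "set (p @ [v]) = {w \<in> V. D v \<subseteq> D w}" using p(2) by simp
    ultimately show ?thesis by blast
  qed
qed

lemma rooted_tree_hasse_tree: "rooted_tree hasse_tree"
  unfolding rooted_tree_def
proof (intro conjI ballI)
  fix u v assume "u \<in> verts hasse_tree" "v \<in> verts hasse_tree"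
  then have reach: "(adjacent hasse_tree)\<^sup>*\<^sup>* r u" "(adjacent hasse_tree)\<^sup>*\<^sup>* r v"
    using root_path_exists is_path_imp_reachable by (metis hasse_tree_simps(1))+
  have "symp (adjacent hasse_tree)" using adjacent_commute by (metis sympI)
  then have "(adjacent hasse_tree)\<^sup>*\<^sup>* u r" using reach(1) by (meson symp_rtranclp sympD)
  then have "(adjacent hasse_tree)\<^sup>*\<^sup>* u v" using reach(2) by (rule rtranclp_trans)
  then show "\<exists>p. is_path hasse_tree u p v"
    using \<open>u \<in> verts hasse_tree\<close> by (rule reachable_imp_is_path[OF simple_graph_hasse_tree])
qed (use simple_graph_hasse_tree acyclic_hasse_tree r_in_V in auto)

lemma ancestor_iff:
  assumes "u \<in> V" "v \<in> V"
  shows "ancestor hasse_tree u v \<longleftrightarrow> D v \<subseteq> D u"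
proof -
  interpret tree hasse_tree using rooted_tree_hasse_tree by unfold_locales
  obtain p where "is_path hasse_tree r p v" "set p = {w \<in> V. D v \<subseteq> D w}"
    using root_path_exists assms by blast
  then show ?thesis using assms the_path_eqI by (auto simp: ancestor_def)
qed

lemma card_le_degree:
  assumes "A \<subseteq> {e \<in> edges hasse_tree. v \<in> e}"
  shows "card A \<le> degree hasse_tree v"
proof -
  have "edges hasse_tree \<subseteq> Pow V" using simple_graph_hasse_tree by (auto simp: simple_graph_def)
  then have "finite {e \<in> edges hasse_tree. v \<in> e}" using finite_V by (simp add: finite_subset)
  then show ?thesis unfolding degree_def using assms by (rule card_mono)
qed

lemma degree_singleton:
  assumes "v \<in> V" "v \<noteq> r" "D v = {x}"
  shows "degree hasse_tree v = 1"
proof -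
  obtain u where u: "covers u v" using covers_exists assms by blast
  have "\<not> covers v w" for w using assms(3) D_nonempty[of w] by (auto simp: covers_def)
  then have "{e \<in> edges hasse_tree. v \<in> e} = {{u, v}}" using u covers_unique by auto
  then show ?thesis by (simp add: degree_def)
qed

lemma degree_ge_2:
  assumes "v \<in> V" "\<nexists>x. D v = {x}"
  shows "2 \<le> degree hasse_tree v"
proof -
  obtain a b where ab: "a \<noteq> b" "covers v a" "covers v b" using two_children assms by blast
  then have "card {{v, a}, {v, b}} = 2" by (auto simp: doubleton_eq_iff)
  moreover have "{{v, a}, {v, b}} \<subseteq> {e \<in> edges hasse_tree. v \<in> e}" using ab by auto
  ultimately show ?thesis using card_le_degree by metis
qed

lemma degree_ge_3:
  assumes "v \<in> V" "\<nexists>x. D v = {x}" "v \<noteq> r"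
  shows "3 \<le> degree hasse_tree v"
proof -
  obtain a b where ab: "a \<noteq> b" "covers v a" "covers v b" using two_children assms by blast
  obtain u where u: "covers u v" using covers_exists assms by blast
  then have "u \<noteq> a" "u \<noteq> b" using ab by (auto simp: covers_def)
  then have "card {{v, a}, {v, b}, {u, v}} = 3" using ab by (auto simp: doubleton_eq_iff)
  moreover have "{{v, a}, {v, b}, {u, v}} \<subseteq> {e \<in> edges hasse_tree. v \<in> e}" using ab u by auto
  ultimately show ?thesis using card_le_degree by metis
qed

lemma phylogenetic_hasse_tree:
  "phylogenetic_tree hasse_tree {v \<in> V. \<exists>x. D v = {x}}"
proof (cases "\<exists>x. D r = {x}")
  case True
  then have "D v = D r" if "v \<in> V" for v
    using D_subset[OF that] D_nonempty[OF that] by (metis subset_singletonD)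
  then have "V = {r}" using D_eqD[OF _ _ r_in_V] r_in_V by blast
  then have "{v \<in> V. \<exists>x. D v = {x}} = {r}" using True by auto
  with \<open>V = {r}\<close> have "verts hasse_tree = {root hasse_tree}"
    "{v \<in> V. \<exists>x. D v = {x}} = {root hasse_tree}"
    unfolding hasse_tree_simps by - assumption+
  then show ?thesis
    unfolding phylogenetic_tree_def using rooted_tree_hasse_tree by (intro conjI disjI2)
next
  case False
  have "v \<noteq> r \<and> degree hasse_tree v = 1 \<longleftrightarrow> (\<exists>x. D v = {x})" if "v \<in> V" for v
  proof
    assume *: "v \<noteq> r \<and> degree hasse_tree v = 1"
    show "\<exists>x. D v = {x}"
    proof (rule ccontr)
      assume "\<nexists>x. D v = {x}"
      then have "3 \<le> degree hasse_tree v" using degree_ge_3[OF that] * by simp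
      then show False using * by simp
    qed
  next
    assume "\<exists>x. D v = {x}"
    then obtain x where x: "D v = {x}" by (rule exE)
    then have "v \<noteq> r" using False by metis
    then show "v \<noteq> r \<and> degree hasse_tree v = 1" using degree_singleton[OF that _ x] by simp
  qed
  then have leaves: "leaves hasse_tree = {v \<in> V. \<exists>x. D v = {x}}"
    unfolding leaves_def by (simp cong: conj_cong)
  have "3 \<le> degree hasse_tree v" if "v \<in> verts hasse_tree - leaves hasse_tree - {root hasse_tree}" for v
    using that degree_ge_3[of v] by (simp add: leaves)
  then show ?thesis
    using leaves rooted_tree_hasse_tree degree_ge_2[OF r_in_V False]
    by (simp add: phylogenetic_tree_def)
qed

end

section \<open>Maps with hierarchy-like neighborhoods are Fitch maps\<close>

lemma fitch_mapI:
  fixes X :: "'a set" and \<epsilon> :: "'a \<times> 'a \<Rightarrow> 'm set"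
  assumes "finite X" "X \<noteq> {}"
    and hier: "hierarchy_like (nbhs X M \<epsilon>)"
    and card: "\<forall>y\<in>X. \<forall>m\<in>M. \<forall>y'\<in>nbh X \<epsilon> m y. card (nbh X \<epsilon> m y') \<le> card (nbh X \<epsilon> m y)"
  shows "fitch_map X M \<epsilon>"
proof -
  define S where "S = nbhs X M \<epsilon> \<union> {X} - range (\<lambda>x. {x})"
  have S_sub: "P \<subseteq> X" "P \<noteq> {}" if "P \<in> nbhs X M \<epsilon> \<union> {X}" for P
    using that assms(2) by (auto simp: nbhs_def nbh_def)
  then have "S \<subseteq> Pow X" unfolding S_def by blast
  then have "finite S" using assms(1) by (simp add: finite_subset)
  then obtain h where h: "bij_betw h {0..<card S} S" using ex_bij_betw_nat_finite by blast
  define V :: "('a + nat) set" where "V = Inl ` X \<union> Inr ` {0..<card S}"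
  define D where "D = case_sum (\<lambda>x. {x}) h"
  have D_simps [simp]: "D (Inl x) = {x}" "D (Inr i) = h i" for x i by (simp_all add: D_def)
  have h_in: "h i \<in> S" if "i < card S" for i using h that by (auto simp: bij_betw_def)
  have D_image: "D ` V = nbhs X M \<epsilon> \<union> {X} \<union> (\<lambda>x. {x}) ` X"
  proof -
    have "D ` V = (\<lambda>x. {x}) ` X \<union> h ` {0..<card S}" by (auto simp: V_def image_Un image_image)
    also have "h ` {0..<card S} = S" using h by (simp add: bij_betw_def)
    finally have DV: "D ` V = (\<lambda>x. {x}) ` X \<union> S" .
    have "x \<in> X" if "{x} \<in> nbhs X M \<epsilon> \<union> {X}" for x using S_sub(1)[OF that] by simp
    then show ?thesis unfolding DV S_def by blast
  qed
  have nested: "P \<subseteq> Q \<or> Q \<subseteq> P" if "P \<in> D ` V" "Q \<in> D ` V" "P \<inter> Q \<noteq> {}" for P Q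
  proof -
    have "\<exists>y. R = {y}" if "R \<in> (\<lambda>x. {x}) ` X" for R using that by blast
    then consider "P \<in> nbhs X M \<epsilon>" "Q \<in> nbhs X M \<epsilon>" | "P = X" | "Q = X"
      | "\<exists>x. P = {x}" | "\<exists>x. Q = {x}"
      using \<open>P \<in> D ` V\<close> \<open>Q \<in> D ` V\<close> unfolding D_image by blast
    then show ?thesis
    proof cases
      case 1
      then have "P \<inter> Q \<in> {P, Q, {}}" using hier by (auto simp: hierarchy_like_def)
      then show ?thesis using that by blast
    qed (use that D_image S_sub in blast)+
  qed
  have "X \<in> D ` V" unfolding D_image by simp
  then obtain r where r: "r \<in> V" "D r = X" by auto
  interpret hierarchy V D r
  proof
    show "finite V" by (simp add: V_def assms(1))
    show "inj_on D V"
    proof (rule inj_onI)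
      fix u v assume uv: "u \<in> V" "v \<in> V" "D u = D v"
      have h_neq: "h i \<noteq> {x}" "{x} \<noteq> h i" if "i < card S" for i x
        using h_in[OF that] by (auto simp: S_def)
      have "i = j" if "i < card S" "j < card S" "h i = h j" for i j
        using h that by (auto simp: bij_betw_def dest: inj_onD)
      then show "u = v" using uv h_neq by (auto simp: V_def)
    qed
    show "\<exists>v\<in>V. D v = {x}" if "x \<in> D r" for x
      using that r(2) by (intro bexI[of _ "Inl x"]) (auto simp: V_def)
    fix u v assume uv: "u \<in> V" "v \<in> V"
    then have "D v \<in> nbhs X M \<epsilon> \<union> {X} \<union> (\<lambda>x. {x}) ` X" using D_image by blast
    then show "D v \<subseteq> D r" "D v \<noteq> {}" using S_sub r(2) by blast+
    show "D u \<subseteq> D v \<or> D v \<subseteq> D u" if "D u \<inter> D v \<noteq> {}"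
      using nested uv that by blast
  qed (use r assms(1) in auto)
  define lab where "lab e = {m \<in> M. \<exists>u w. e = {u, w} \<and> D w \<subset> D u \<and> (\<exists>y\<in>X. D w = nbh X \<epsilon> m y)}"
    for e
  have lab_iff: "m \<in> lab {u, w} \<longleftrightarrow> m \<in> M \<and> (\<exists>y\<in>X. D w = nbh X \<epsilon> m y)" if "D w \<subset> D u" for m u w
    using that by (auto simp: lab_def doubleton_eq_iff)
  have "Inl ` X = {v \<in> V. \<exists>x. D v = {x}}"
  proof -
    have "h i \<noteq> {x}" if "i < card S" for i x using h_in[OF that] by (auto simp: S_def)
    then show ?thesis by (auto simp: V_def)
  qed
  then have "phylogenetic_tree hasse_tree (Inl ` X)" using phylogenetic_hasse_tree by simp
  then have "edge_labeled_tree hasse_tree lab X M" by (auto simp: edge_labeled_tree_def lab_def)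
  moreover have "explains hasse_tree lab X M \<epsilon>"
  proof -
    have XV: "Inl ` X \<subseteq> V" by (simp add: V_def)
    have "m \<in> \<epsilon> (x, y) \<longleftrightarrow>
      (\<exists>u w. adjacent hasse_tree u w \<and> ancestor hasse_tree u w \<and> ancestor hasse_tree w (Inl y) \<and>
         \<not> ancestor hasse_tree w (Inl x) \<and> m \<in> lab {u, w})" (is "_ \<longleftrightarrow> ?R")
      if xy: "x \<in> X" "y \<in> X" "x \<noteq> y" and m: "m \<in> M" for x y m
    proof
      assume "m \<in> \<epsilon> (x, y)"
      then have x: "x \<notin> nbh X \<epsilon> m y" and y: "y \<in> nbh X \<epsilon> m y" using xy by (auto simp: nbh_def)
      have "nbh X \<epsilon> m y \<in> D ` V" using D_image m xy by (auto simp: nbhs_def)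
      then obtain w where w: "w \<in> V" "D w = nbh X \<epsilon> m y" by auto
      then have "w \<noteq> r" using x r xy by auto
      then obtain u where u: "covers u w" using covers_exists w by blast
      then have "u \<in> V" "D w \<subset> D u" by (auto simp: covers_def)
      moreover from this have "m \<in> lab {u, w}" using lab_iff w m xy by blast
      ultimately show ?R
        using u w x y xy XV by (intro exI[of _ u] exI[of _ w]) (auto simp: adjacent_iff ancestor_iff)
    next
      assume ?R
      then obtain u w where uw: "adjacent hasse_tree u w" "ancestor hasse_tree u w"
        and w: "ancestor hasse_tree w (Inl y)" "\<not> ancestor hasse_tree w (Inl x)"
        and l: "m \<in> lab {u, w}" by blast
      have V: "u \<in> V" "w \<in> V" "u \<noteq> w" using adjacent_verts[OF simple_graph_hasse_tree uw(1)] by auto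
      have "D w \<subset> D u" using uw V ancestor_iff D_eqD by blast
      then obtain z where z: "z \<in> X" "D w = nbh X \<epsilon> m z" using l lab_iff by blast
      have Dw: "y \<in> D w" "x \<notin> D w" using w V XV xy by (auto simp: ancestor_iff)
      have nb: "nbh X \<epsilon> m y \<in> nbhs X M \<epsilon>" "D w \<in> nbhs X M \<epsilon>" using xy m z by (auto simp: nbhs_def)
      have "y \<in> nbh X \<epsilon> m y" by (simp add: nbh_def)
      then have "nbh X \<epsilon> m y \<subseteq> D w \<or> D w \<subseteq> nbh X \<epsilon> m y"
        using hier nb Dw unfolding hierarchy_like_def by blast
      moreover have "card (nbh X \<epsilon> m y) \<le> card (D w)" using card z m Dw by auto
      moreover have "finite (nbh X \<epsilon> m y)" using assms(1) by (simp add: nbh_def)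
      ultimately have "nbh X \<epsilon> m y \<subseteq> D w" using card_seteq by blast
      then show "m \<in> \<epsilon> (x, y)" using Dw xy by (auto simp: nbh_def)
    qed
    then show ?thesis
      unfolding explains_iff[OF rooted_tree_hasse_tree, of X, simplified, OF XV] irr_def by auto
  qed
  ultimately show ?thesis unfolding fitch_map_def by blast
qed

theorem theorem1:
  fixes X :: "'a set" and M :: "'m set" and \<epsilon> :: "'a \<times> 'a \<Rightarrow> 'm set"
  assumes "finite X" and "X \<noteq> {}"
    and "finite M" and "M \<noteq> {}"
    and "\<epsilon> \<in> irr X \<rightarrow> Pow M"
  shows "fitch_map X M \<epsilon> \<longleftrightarrow>
    hierarchy_like (nbhs X M \<epsilon>) \<and>
    (\<forall>y\<in>X. \<forall>m\<in>M. \<forall>y'\<in>nbh X \<epsilon> m y. card (nbh X \<epsilon> m y') \<le> card (nbh X \<epsilon> m y))"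
  using fitch_map_imp[OF assms(1)] fitch_mapI[OF assms(1,2)] by blast

end
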